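(* Let $N\ge3$ be an integer, $s\in(0,1)$, and let $G$ and $\Psi$ be Young functions such that $$\lim_{t\to0}\frac{\Psi(|t|)}{G(|t|)}=\lim_{t\to\infty}\frac{\Psi(|t|)}{G_*(|t|)}=0,$$ where $G_*$ is the Sobolev conjugate function of $G$. Let $(u_n)\subset W^{s,G}(\mathbb{R}^N)$ be a sequence such that $$\left(\int_{\mathbb{R}^N}G(|u_n|)\,dx\right)_n\quad\text{and}\quad\left(\int_{\mathbb{R}^N}G_*(|u_n|)\,dx\right)_n$$ are bounded, and for each $\tau>0$ $$\operatorname{mes}\left(\{x\in\mathbb{R}^N:|u_n(x)|>\tau\}\right)\to0\quad\text{as }n\to+\infty.$$ Then $$\int_{\mathbb{R}^N}\Psi(|u_n|)\,dx\to0\quad\text{as }n\to+\infty.$$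
   Context: A Young function is a map $G:[0,\infty)\to[0,\infty)$ of the form $G(t)=\int_0^t g(\tau)\,d\tau$ where $g:[0,\infty)\to[0,\infty)$ is right continuous, $g(0)=0$, $g(t)>0$ for $t>0$, $g$ is non-decreasing on $(0,\infty)$ and $\lim_{t\to\infty}g(t)=\infty$. $\operatorname{mes}$ is Lebesgue measure. With $D_su(x,y)=\frac{u(x)-u(y)}{|x-y|^s}$ and $d\mu=\frac{dx\,dy}{|x-y|^N}$, $L^G(\mathbb{R}^N)$ is the set of measurable $u:\mathbb{R}^N\to\mathbb{R}$ with $\int_{\mathbb{R}^N}G(\lambda|u|)\,dx<\infty$ for some $\lambda>0$, and $W^{s,G}(\mathbb{R}^N)$ is the set of $u\in L^G(\mathbb{R}^N)$ with $\iint_{\mathbb{R}^N\times\mathbb{R}^N}G(\lambda|D_su|)\,d\mu<\infty$ for some $\lambda>0$. Standing assumption for the definition of $G_*$: $\int_0^1\frac{G^{-1}(\tau)}{\tau^{(N+s)/N}}\,d\tau<\infty$ and $\int_1^{+\infty}\frac{G^{-1}(\tau)}{\tau^{(N+s)/N}}\,d\tau=\infty$. The Sobolev conjugate $G_*$ is then defined by $G_*^{-1}(t)=\int_0^t\frac{G^{-1}(\tau)}{\tau^{(N+s)/N}}\,d\tau$ for $t>0$. *)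

theory Defs
  imports "HOL-Analysis.Analysis"
begin

text \<open>
  Functions on \<open>[0,\<infinity>)\<close> are represented by total functions on the reals; values at negative
  arguments are unconstrained and never used.
\<close>

definition young_density :: "(real \<Rightarrow> real) \<Rightarrow> bool" where
  "young_density g \<longleftrightarrow>
     (\<forall>t\<ge>0. continuous (at_right t) g) \<and>
     g 0 = 0 \<and>
     (\<forall>t>0. g t > 0) \<and>
     mono_on {0<..} g \<and>
     filterlim g at_top at_top"

definition young_function :: "(real \<Rightarrow> real) \<Rightarrow> bool" where
  "young_function G \<longleftrightarrow>
     (\<exists>g. young_density g \<and> (\<forall>t\<ge>0. G t = (LBINT \<tau>:{0..t}. g \<tau>)))"

definition orlicz_space :: "(real \<Rightarrow> real) \<Rightarrow> (real ^ 'n \<Rightarrow> real) set" where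
  "orlicz_space G =
     {u \<in> borel_measurable lebesgue.
        \<exists>c>0. (\<integral>\<^sup>+x. ennreal (G (c * \<bar>u x\<bar>)) \<partial>lebesgue) < \<infinity>}"

definition holder_quotient :: "real \<Rightarrow> (real ^ 'n \<Rightarrow> real) \<Rightarrow> (real ^ 'n) \<times> (real ^ 'n) \<Rightarrow> real" where
  "holder_quotient s u = (\<lambda>(x, y). (u x - u y) / norm (x - y) powr s)"

text \<open>
  The measure \<open>dx dy / |x - y|\<^sup>N\<close>. On the diagonal, a Lebesgue null set, the density is \<open>0\<close>
  because of division by zero.
\<close>

definition kernel_measure :: "((real ^ 'n) \<times> (real ^ 'n)) measure" where
  "kernel_measure = density lebesgue (\<lambda>(x, y). ennreal (1 / norm (x - y) ^ CARD('n)))"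

definition orlicz_sobolev_space :: "real \<Rightarrow> (real \<Rightarrow> real) \<Rightarrow> (real ^ 'n \<Rightarrow> real) set" where
  "orlicz_sobolev_space s G =
     {u \<in> orlicz_space G.
        \<exists>c>0. (\<integral>\<^sup>+z. ennreal (G (c * \<bar>holder_quotient s u z\<bar>)) \<partial>kernel_measure) < \<infinity>}"

text \<open>
  A Young function is a bijection of \<open>[0,\<infinity>)\<close> onto itself; \<open>the_inv_into {0..} G\<close> is its inverse.
\<close>

definition conjugate_integrand :: "nat \<Rightarrow> real \<Rightarrow> (real \<Rightarrow> real) \<Rightarrow> real \<Rightarrow> real" where
  "conjugate_integrand N s G \<tau> = the_inv_into {0..} G \<tau> / \<tau> powr ((real N + s) / real N)"

definition conjugate_admissible :: "nat \<Rightarrow> real \<Rightarrow> (real \<Rightarrow> real) \<Rightarrow> bool" where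
  "conjugate_admissible N s G \<longleftrightarrow>
     (\<integral>\<^sup>+\<tau>\<in>{0<..1}. ennreal (conjugate_integrand N s G \<tau>) \<partial>lborel) < \<infinity> \<and>
     (\<integral>\<^sup>+\<tau>\<in>{1..}. ennreal (conjugate_integrand N s G \<tau>) \<partial>lborel) = \<infinity>"

text \<open>
  Under \<open>conjugate_admissible\<close>, the integral below is a bijection of \<open>[0,\<infinity>)\<close> onto itself as a
  function of \<open>t\<close>, and the Sobolev conjugate is its inverse.
\<close>

definition sobolev_conjugate_inv :: "nat \<Rightarrow> real \<Rightarrow> (real \<Rightarrow> real) \<Rightarrow> real \<Rightarrow> real" where
  "sobolev_conjugate_inv N s G t = (LBINT \<tau>:{0<..t}. conjugate_integrand N s G \<tau>)"

definition sobolev_conjugate :: "nat \<Rightarrow> real \<Rightarrow> (real \<Rightarrow> real) \<Rightarrow> real \<Rightarrow> real" where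
  "sobolev_conjugate N s G = the_inv_into {0..} (sobolev_conjugate_inv N s G)"

end

theory Submission
  imports Defs
begin

text \<open>
  Near \<open>0\<close> the integrand \<open>\<Psi>(|u|)\<close> is dominated by \<open>\<epsilon> G(|u|)\<close>, for large \<open>|u|\<close> by \<open>\<epsilon> G\<^sub>*(|u|)\<close>, and
  in between by a constant on the set \<open>|u| > \<tau>\<close>, whose measure tends to \<open>0\<close>. Both \<open>G\<close> and
  \<open>G\<^sub>*\<inverse>\<close> are primitives of positive functions with infinite total mass, hence increasing
  bijections of the half-line, which makes \<open>G\<^sub>*\<close> nonnegative, increasing and positive off \<open>0\<close>.
\<close>

section \<open>Primitives of positive functions on the half-line\<close>

text \<open>The two integrands differ by \<open>h\<close> on \<open>{a<..b}\<close> and agree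
  elsewhere. A zero integral of this nonnegative difference would make \<open>{a<..b}\<close> a null
  set, although its measure is \<open>b - a > 0\<close>.\<close>

lemma integral_less_on_positive:
  fixes h :: "real \<Rightarrow> real"
  assumes int: "\<And>t. set_integrable lborel {0..t} h"
    and pos: "\<And>t. t > 0 \<Longrightarrow> h t > 0" and "0 \<le> a" "a < b"
  shows "(LBINT x:{0..a}. h x) < (LBINT x:{0..b}. h x)"
proof -
  let ?X = "\<lambda>x. indicator {0..a} x *\<^sub>R h x" and ?Y = "\<lambda>x. indicator {0..b} x *\<^sub>R h x"
  have X: "integrable lborel ?X" and Y: "integrable lborel ?Y"
    using int by (auto simp: set_integrable_def)
  have d: "integrable lborel (\<lambda>x. ?Y x - ?X x)"
    using X Y by simp
  have "AE x in lborel. x \<noteq> (0::real)"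
    by (rule AE_lborel_singleton)
  then have nonneg: "AE x in lborel. 0 \<le> ?Y x - ?X x"
  proof eventually_elim
    case (elim x)
    then show ?case
      using pos[of x] assms by (cases "0 < x") (auto simp: indicator_def)
  qed
  have "integral\<^sup>L lborel (\<lambda>x. ?Y x - ?X x) \<noteq> 0"
  proof
    assume "integral\<^sup>L lborel (\<lambda>x. ?Y x - ?X x) = 0"
    then have "AE x in lborel. ?Y x - ?X x = 0"
      using integral_nonneg_eq_0_iff_AE[OF d nonneg] by simp
    then have "AE x in lborel. x \<notin> {a<..b}"
    proof eventually_elim
      case (elim x)
      then show ?case
        using pos[of x] \<open>0 \<le> a\<close> by (force simp: indicator_def)
    qed
    then have "emeasure lborel {a<..b} = 0"
      by (subst (asm) AE_iff_measurable[of "{a<..b}"]) auto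
    then show False
      using assms by simp
  qed
  then have "integral\<^sup>L lborel (\<lambda>x. ?Y x - ?X x) > 0"
    using integral_nonneg_AE[OF nonneg] by simp
  then show ?thesis
    using X Y by (simp add: set_lebesgue_integral_def)
qed

lemma primitive_continuous_on:
  fixes h :: "real \<Rightarrow> real"
  assumes int: "\<And>t. set_integrable lborel {0..t} h"
  shows "continuous_on {0..} (\<lambda>t. LBINT x:{0..t}. h x)"
proof -
  have eq: "(LBINT x:{0..t}. h x) = integral {0..t} h" and "h integrable_on {0..t}" for t
    using set_borel_integral_eq_integral[OF int] by auto
  then have *: "continuous_on {0..T} (\<lambda>t. LBINT x:{0..t}. h x)" for T
    using indefinite_integral_continuous_1[of h 0 T] by simp
  show ?thesis
  proof (rule continuous_on_eq_continuous_within[THEN iffD2], rule ballI)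
    fix t :: real assume t: "t \<in> {0..}"
    have "continuous (at t within {0..t+1}) (\<lambda>t. LBINT x:{0..t}. h x)"
      using *[of "t+1"] t by (auto simp: continuous_on_eq_continuous_within)
    \<comment> \<open>The neighbourhood \<open>{..<t+1}\<close> of \<open>t\<close> meets both sets
      in the same points, so continuity on compact intervals passes to the half-line.\<close>
    moreover have "at t within {0..t+1} = at t within {0..}"
      by (rule at_within_nhd[of _ "{..<t+1}"]) auto
    ultimately show "continuous (at t within {0..}) (\<lambda>t. LBINT x:{0..t}. h x)"
      by (simp add: continuous_within)
  qed
qed

text \<open>The truncations of \<open>h\<close> to \<open>{0..real n}\<close> increase to
  \<open>h\<close> on the half-line. If their integrals all stayed below \<open>B\<close>, monotone
  convergence would bound the total mass by the finite value \<open>ennreal B\<close>.\<close>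

lemma primitive_unbounded:
  fixes h :: "real \<Rightarrow> real"
  assumes int: "\<And>t. set_integrable lborel {0..t} h"
    and nonneg: "\<And>t. t \<ge> 0 \<Longrightarrow> h t \<ge> 0"
    and inf: "(\<integral>\<^sup>+x\<in>{0..}. ennreal (h x) \<partial>lborel) = \<infinity>"
  shows "\<exists>n::nat. (LBINT x:{0..real n}. h x) > B"
proof (rule ccontr)
  assume "\<not> ?thesis"
  then have le: "(LBINT x:{0..real n}. h x) \<le> B" for n by (meson not_le)
  let ?f = "\<lambda>(n::nat) x. ennreal (indicator {0..real n} x *\<^sub>R h x)"
  have meas: "?f n \<in> borel_measurable lborel" for n
    using int[of "real n"] by (auto simp: set_integrable_def)
  have fin: "(\<integral>\<^sup>+x. ?f n x \<partial>lborel) \<le> ennreal B" for n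
  proof -
    have "(\<integral>\<^sup>+x. ?f n x \<partial>lborel) = ennreal (LBINT x:{0..real n}. h x)"
      using int[of "real n"] nonneg unfolding set_integrable_def set_lebesgue_integral_def
      by (intro nn_integral_eq_integral) (auto simp: indicator_def)
    then show ?thesis using le[of n] by (simp add: ennreal_leI)
  qed
  have "(\<integral>\<^sup>+x\<in>{0..}. ennreal (h x) \<partial>lborel) = (\<integral>\<^sup>+x. (SUP n. ?f n x) \<partial>lborel)"
  proof (rule nn_integral_cong)
    fix x :: real
    obtain m :: nat where m: "x \<le> real m" using real_arch_simple by blast
    show "ennreal (h x) * indicator {0..} x = (SUP n. ?f n x)"
    proof (rule antisym)
      show "ennreal (h x) * indicator {0..} x \<le> (SUP n. ?f n x)"
        by (rule SUP_upper2[of m]) (use m in \<open>auto simp: indicator_def\<close>)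
      show "(SUP n. ?f n x) \<le> ennreal (h x) * indicator {0..} x"
        by (rule SUP_least) (auto simp: indicator_def)
    qed
  qed
  also have "\<dots> = (SUP n. (\<integral>\<^sup>+x. ?f n x \<partial>lborel))"
  proof (rule nn_integral_monotone_convergence_SUP)
    show "incseq ?f"
      by (intro incseq_SucI le_funI) (auto simp: indicator_def)
  qed (rule meas)
  also have "\<dots> \<le> ennreal B"
    by (rule SUP_least) (rule fin)
  finally show False
    using inf by (simp add: top_unique)
qed

text \<open>Common source of the bijectivity of \<open>G\<close> and of
  \<open>sobolev_conjugate_inv\<close>: strict growth gives injectivity, and continuity together
  with unboundedness gives surjectivity by the intermediate value theorem. \<open>F\<close> is
  prescribed for \<open>t \<ge> 0\<close> only, as a Young function is arbitrary at negative
  arguments.\<close>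

lemma primitive_bij_betw:
  fixes h :: "real \<Rightarrow> real"
  assumes int: "\<And>t. set_integrable lborel {0..t} h"
    and pos: "\<And>t. t > 0 \<Longrightarrow> h t > 0" and "h 0 = 0"
    and inf: "(\<integral>\<^sup>+x\<in>{0..}. ennreal (h x) \<partial>lborel) = \<infinity>"
    and F: "\<And>t. t \<ge> 0 \<Longrightarrow> F t = (LBINT x:{0..t}. h x)"
  shows "strict_mono_on {0..} F" and "bij_betw F {0..} {0..}" and "F 0 = 0"
proof -
  show mono: "strict_mono_on {0..} F"
    by (rule strict_mono_onI) (simp add: F integral_less_on_positive[OF int pos])
  have "(\<lambda>x. indicator {0} x *\<^sub>R h x) = (\<lambda>_. 0)"
    using \<open>h 0 = 0\<close> by (auto simp: indicator_def)
  then show F0: "F 0 = 0"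
    by (simp add: F set_lebesgue_integral_def)
  have nonneg: "h t \<ge> 0" if "t \<ge> 0" for t
    using pos[of t] \<open>h 0 = 0\<close> that by (cases "t = 0") auto
  have cont: "continuous_on {0..} F"
    using primitive_continuous_on[OF int] by (rule continuous_on_eq) (simp add: F)
  have "F ` {0..} = {0..}"
  proof (intro equalityI subsetI)
    fix y assume "y \<in> F ` {0..}"
    then show "y \<in> {0..}"
      using strict_mono_onD[OF mono, of 0] F0 by (force simp: le_less)
  next
    fix y :: real assume y: "y \<in> {0..}"
    obtain n :: nat where "F (real n) > y"
      using primitive_unbounded[OF int nonneg inf] by (auto simp: F)
    moreover have "continuous_on {0..real n} F"
      using cont by (rule continuous_on_subset) auto
    ultimately obtain x where "0 \<le> x" "F x = y"
      using IVT'[of F 0 y "real n"] y F0 by auto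
    then show "y \<in> F ` {0..}" by auto
  qed
  then show "bij_betw F {0..} {0..}"
    using mono by (auto simp: bij_betw_def strict_mono_on_imp_inj_on)
qed

section \<open>Inverses and measurability of increasing functions on the half-line\<close>

text \<open>Serves twice: for the inverse of \<open>G\<close> inside the conjugate integrand, and
  for passing from \<open>sobolev_conjugate_inv\<close> to \<open>sobolev_conjugate\<close>.\<close>

lemma the_inv_into_strict_mono_on:
  fixes F :: "real \<Rightarrow> real"
  assumes mono: "strict_mono_on {0..} F" and bij: "bij_betw F {0..} {0..}" and F0: "F 0 = 0"
  shows "strict_mono_on {0..} (the_inv_into {0..} F)" and "the_inv_into {0..} F 0 = 0"
proof -
  let ?I = "the_inv_into {0..} F"
  have inj: "inj_on F {0..}" and im: "F ` {0..} = {0..}"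
    using bij by (auto simp: bij_betw_def)
  have I: "?I y \<ge> 0" "F (?I y) = y" if "y \<ge> 0" for y
    using that im the_inv_into_into[OF inj, of y "{0..}"] f_the_inv_into_f[OF inj, of y] by auto
  show "strict_mono_on {0..} ?I"
  proof (rule strict_mono_onI)
    fix x y :: real assume xy: "x \<in> {0..}" "y \<in> {0..}" "x < y"
    show "?I x < ?I y"
    proof (rule ccontr)
      assume "\<not> ?I x < ?I y"
      then have "F (?I y) \<le> F (?I x)"
        using strict_mono_on_leD[OF mono, of "?I y" "?I x"] I xy by auto
      then show False using I xy by auto
    qed
  qed
  show "?I 0 = 0"
    using the_inv_into_f_f[OF inj, of 0] F0 by simp
qed

text \<open>Since \<open>F\<close> is arbitrary at negative arguments, it need not be Borel itself.
  Clamping the argument at 0 makes it monotone on the whole line.\<close>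

lemma borel_measurable_mono_on_max:
  fixes F :: "real \<Rightarrow> real"
  assumes "strict_mono_on {0..} F"
  shows "(\<lambda>x. F (max 0 x)) \<in> borel_measurable borel"
  by (rule borel_measurable_mono)
    (auto intro!: monoI strict_mono_on_leD[OF assms])

lemma borel_measurable_mono_on_abs:
  fixes F :: "real \<Rightarrow> real"
  assumes F: "strict_mono_on {0..} F" and [measurable]: "f \<in> borel_measurable M"
  shows "(\<lambda>x. F \<bar>f x\<bar>) \<in> borel_measurable M"
proof -
  note [measurable] = borel_measurable_mono_on_max[OF F]
  have "(\<lambda>x. (\<lambda>y. F (max 0 y)) \<bar>f x\<bar>) \<in> borel_measurable M"
    by measurable
  then show ?thesis by simp
qed

lemma emeasure_lborel_atLeast:
  "emeasure lborel {a::real..} = \<infinity>"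
proof (cases "emeasure lborel {a..}")
  case (real r)
  have "emeasure lborel {a..a + (r + 1)} \<le> emeasure lborel {a..}"
    by (rule emeasure_mono) auto
  then show ?thesis
    using real by simp
qed simp

section \<open>Young functions and inverse Sobolev conjugates as increasing bijections\<close>

text \<open>Monotonicity of the density does both jobs: it bounds \<open>g\<close> by
  \<open>g t\<close> on \<open>{0..t}\<close>, hence local integrability, and it keeps
  \<open>g\<close> above \<open>g 1 > 0\<close> on \<open>{1..}\<close>, hence infinite total
  mass.\<close>

lemma young_function_bij_betw:
  assumes "young_function G"
  shows "strict_mono_on {0..} G" and "bij_betw G {0..} {0..}" and "G 0 = 0"
proof -
  from assms obtain g where g: "young_density g"
    and G: "\<And>t. t \<ge> 0 \<Longrightarrow> G t = (LBINT \<tau>:{0..t}. g \<tau>)"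
    unfolding young_function_def by auto
  have g0: "g 0 = 0" and pos: "\<And>t. t > 0 \<Longrightarrow> g t > 0" and mono: "mono_on {0<..} g"
    using g unfolding young_density_def by auto
  \<comment> \<open>The definition gives monotonicity on the open half-line; \<open>g 0 = 0\<close>
    and positivity extend it to 0.\<close>
  have le: "g x \<le> g y" if "0 \<le> x" "x \<le> y" for x y
  proof (cases "x = 0")
    case True
    then show ?thesis using that g0 pos[of y] by (cases "y = 0") auto
  next
    case False
    then show ?thesis using that by (intro mono_onD[OF mono]) auto
  qed
  have [measurable]: "(\<lambda>x. g (max 0 x)) \<in> borel_measurable borel"
    by (rule borel_measurable_mono) (auto intro!: monoI le)
  have int: "set_integrable lborel {0..t} g" for t
  proof (rule set_integrable_bound)
    show "set_integrable lborel {0..t} (\<lambda>_. g \<bar>t\<bar>)"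
      by (rule borel_integrable_atLeastAtMost') simp
    have "(\<lambda>x. indicator {0..t} x *\<^sub>R g (max 0 x)) \<in> borel_measurable lborel"
      by measurable
    also have "(\<lambda>x. indicator {0..t} x *\<^sub>R g (max 0 x)) = (\<lambda>x. indicator {0..t} x *\<^sub>R g x)"
      by (auto simp: indicator_def)
    finally show "set_borel_measurable lborel {0..t} g"
      by (simp add: set_borel_measurable_def)
    show "AE x in lborel. x \<in> {0..t} \<longrightarrow> norm (g x) \<le> norm (g \<bar>t\<bar>)"
    proof (intro AE_I2 impI)
      fix x assume "x \<in> {0..t}"
      then show "norm (g x) \<le> norm (g \<bar>t\<bar>)"
        using le[of x t] le[of 0 x] g0 by auto
    qed
  qed
  have "(\<integral>\<^sup>+x. ennreal (g 1) * indicator {1::real..} x \<partial>lborel)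
      \<le> (\<integral>\<^sup>+x\<in>{0..}. ennreal (g x) \<partial>lborel)"
    by (rule nn_integral_mono) (auto simp: indicator_def intro!: ennreal_leI le)
  moreover have "(\<integral>\<^sup>+x. ennreal (g 1) * indicator {1::real..} x \<partial>lborel) = \<infinity>"
    using pos[of 1] by (simp add: nn_integral_cmult_indicator emeasure_lborel_atLeast ennreal_mult_top)
  ultimately have inf: "(\<integral>\<^sup>+x\<in>{0..}. ennreal (g x) \<partial>lborel) = \<infinity>"
    by (simp add: top_unique)
  show "strict_mono_on {0..} G" "bij_betw G {0..} {0..}" "G 0 = 0"
    using primitive_bij_betw[OF int pos g0 inf G] by auto
qed

text \<open>The first admissibility condition gives integrability of the integrand near 0, the
  second its infinite total mass. On \<open>{1..t}\<close> the denominator is at least 1, so the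
  integrand is bounded by the inverse of \<open>G\<close> at \<open>t\<close>.\<close>

lemma sobolev_conjugate_inv_bij_betw:
  assumes G: "young_function G" and adm: "conjugate_admissible N s G"
    and N: "N > 0" and s: "s > 0"
  shows "strict_mono_on {0..} (sobolev_conjugate_inv N s G)"
    and "bij_betw (sobolev_conjugate_inv N s G) {0..} {0..}"
    and "sobolev_conjugate_inv N s G 0 = 0"
proof -
  let ?h = "conjugate_integrand N s G" and ?I = "the_inv_into {0..} G"
  note I = the_inv_into_strict_mono_on[OF young_function_bij_betw[OF G]]
  \<comment> \<open>Here \<open>0 powr p = 0\<close> and division by zero yields 0. This value lets
    \<open>{0<..t}\<close> be exchanged for \<open>{0..t}\<close> below.\<close>
  have h0: "?h 0 = 0"
    by (simp add: conjugate_integrand_def)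
  have pos: "?h t > 0" if "t > 0" for t
    using strict_mono_onD[OF I(1), of 0 t] I(2) that by (simp add: conjugate_integrand_def)
  have nonneg: "?h t \<ge> 0" if "t \<ge> 0" for t
    using pos[of t] h0 that by (cases "t = 0") auto
  note [measurable] = borel_measurable_mono_on_max[OF I(1)]
  have meas: "set_borel_measurable lborel A ?h" if [measurable]: "A \<in> sets borel" and "A \<subseteq> {0..}" for A
  proof -
    have "(\<lambda>x. indicator A x *\<^sub>R (?I (max 0 x) / x powr ((real N + s) / real N)))
        \<in> borel_measurable lborel"
      by measurable
    also have "(\<lambda>x. indicator A x *\<^sub>R (?I (max 0 x) / x powr ((real N + s) / real N)))
        = (\<lambda>x. indicator A x *\<^sub>R ?h x)"
      using that(2) by (auto simp: indicator_def conjugate_integrand_def max_def fun_eq_iff)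
    finally show ?thesis
      by (simp add: set_borel_measurable_def)
  qed
  have int01: "set_integrable lborel {0<..1} ?h"
    unfolding set_integrable_def
  proof (rule integrableI_nonneg)
    show "(\<lambda>x. indicator {0<..1} x *\<^sub>R ?h x) \<in> borel_measurable lborel"
      using meas[of "{0<..1}"] by (force simp: set_borel_measurable_def)
    show "AE x in lborel. 0 \<le> indicator {0<..1} x *\<^sub>R ?h x"
      using nonneg by (auto simp: indicator_def)
    have "(\<integral>\<^sup>+x. ennreal (indicator {0<..1} x *\<^sub>R ?h x) \<partial>lborel)
       = (\<integral>\<^sup>+\<tau>\<in>{0<..1}. ennreal (?h \<tau>) \<partial>lborel)"
      by (rule nn_integral_cong) (auto simp: indicator_def)
    then show "(\<integral>\<^sup>+x. ennreal (indicator {0<..1} x *\<^sub>R ?h x) \<partial>lborel) < \<infinity>"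
      using adm by (simp add: conjugate_admissible_def)
  qed
  have int1: "set_integrable lborel {1..t} ?h" for t
  proof (rule set_integrable_bound)
    show "set_integrable lborel {1..t} (\<lambda>_. ?I \<bar>t\<bar>)"
      by (rule borel_integrable_atLeastAtMost') simp
    show "set_borel_measurable lborel {1..t} ?h"
      by (rule meas) auto
    show "AE x in lborel. x \<in> {1..t} \<longrightarrow> norm (?h x) \<le> norm (?I \<bar>t\<bar>)"
    proof (intro AE_I2 impI)
      fix x assume x: "x \<in> {1..t}"
      have "0 \<le> ?I x" "?I x \<le> ?I t"
        using strict_mono_on_leD[OF I(1), of 0 x] strict_mono_on_leD[OF I(1), of x t] I(2) x by auto
      moreover have "1 \<le> x powr ((real N + s) / real N)"
        using x N s by (intro ge_one_powr_ge_zero) auto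
      ultimately have "?I x / x powr ((real N + s) / real N) \<le> ?I t / 1"
        by (intro frac_le) auto
      then show "norm (?h x) \<le> norm (?I \<bar>t\<bar>)"
        using nonneg[of x] x by (auto simp: conjugate_integrand_def)
    qed
  qed
  have int: "set_integrable lborel {0..t} ?h" for t
  proof -
    \<comment> \<open>The union contains \<open>{0<..t}\<close> for every \<open>t\<close>, also for
      \<open>t < 1\<close>, so no case distinction arises.\<close>
    have "set_integrable lborel ({0<..1} \<union> {1..t}) ?h"
      by (rule set_integrable_Un[OF int01 int1]) auto
    then have "set_integrable lborel {0<..t} ?h"
      by (rule set_integrable_subset) auto
    moreover have "(\<lambda>x. indicator {0<..t} x *\<^sub>R ?h x) = (\<lambda>x. indicator {0..t} x *\<^sub>R ?h x)"
      using h0 by (auto simp: indicator_def fun_eq_iff)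
    ultimately show ?thesis
      by (simp add: set_integrable_def)
  qed
  have "(\<integral>\<^sup>+\<tau>\<in>{1..}. ennreal (?h \<tau>) \<partial>lborel) \<le> (\<integral>\<^sup>+x\<in>{0..}. ennreal (?h x) \<partial>lborel)"
    by (rule nn_integral_mono) (auto simp: indicator_def)
  then have inf: "(\<integral>\<^sup>+x\<in>{0..}. ennreal (?h x) \<partial>lborel) = \<infinity>"
    using adm by (simp add: conjugate_admissible_def top_unique)
  have F: "sobolev_conjugate_inv N s G t = (LBINT x:{0..t}. ?h x)" for t
    unfolding sobolev_conjugate_inv_def set_lebesgue_integral_def
    by (rule Bochner_Integration.integral_cong) (use h0 in \<open>auto simp: indicator_def\<close>)
  show "strict_mono_on {0..} (sobolev_conjugate_inv N s G)"
    "bij_betw (sobolev_conjugate_inv N s G) {0..} {0..}"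
    "sobolev_conjugate_inv N s G 0 = 0"
    using primitive_bij_betw[OF int pos h0 inf F] by auto
qed

section \<open>The pointwise estimate and the convergence of the integrals\<close>

text \<open>Positivity of \<open>g\<close> allows the denominator to be cleared: where
  \<open>g\<close> vanishes, the quotient is 0 by convention and says nothing about
  \<open>f\<close>.\<close>

lemma eventually_le_mult_if_ratio_tendsto_0:
  fixes f g :: "'a \<Rightarrow> real"
  assumes lim: "((\<lambda>t. f t / g t) \<longlongrightarrow> 0) A"
    and pos: "eventually (\<lambda>t. g t > 0) A" and "\<epsilon> > 0"
  shows "eventually (\<lambda>t. f t \<le> \<epsilon> * g t) A"
  using order_tendstoD(2)[OF lim \<open>\<epsilon> > 0\<close>] pos
  by eventually_elim (simp add: pos_divide_less_eq)

text \<open>Puts the three ranges into one inequality that can be integrated term by term;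
  \<open>H\<close> stands for the Sobolev conjugate.\<close>

lemma three_range_bound:
  fixes \<Psi> G H :: "real \<Rightarrow> real"
  assumes G: "strict_mono_on {0..} G" "G 0 = 0" and H: "strict_mono_on {0..} H" "H 0 = 0"
    and P: "strict_mono_on {0..} \<Psi>" "\<Psi> 0 = 0"
    and lim0: "((\<lambda>t. \<Psi> \<bar>t\<bar> / G \<bar>t\<bar>) \<longlongrightarrow> 0) (at 0)"
    and lim_top: "((\<lambda>t. \<Psi> \<bar>t\<bar> / H \<bar>t\<bar>) \<longlongrightarrow> 0) at_top" and \<epsilon>: "\<epsilon> > 0"
  shows "\<exists>\<tau>>0. \<exists>K\<ge>0. \<forall>t\<ge>0. \<Psi> t \<le> \<epsilon> * G t + \<epsilon> * H t + K * indicator {\<tau><..} t"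
proof -
  have nonneg: "G t \<ge> 0" "H t \<ge> 0" "\<Psi> t \<ge> 0" if "t \<ge> 0" for t
    using strict_mono_on_leD[OF G(1), of 0 t] strict_mono_on_leD[OF H(1), of 0 t]
      strict_mono_on_leD[OF P(1), of 0 t] G H P that by auto
  have "eventually (\<lambda>t. G \<bar>t\<bar> > 0) (at 0)"
    using strict_mono_onD[OF G(1), of 0] G(2) by (auto simp: eventually_at_filter)
  from eventually_le_mult_if_ratio_tendsto_0[OF lim0 this \<epsilon>]
  obtain d where d: "d > 0" "\<And>t. t \<noteq> 0 \<Longrightarrow> \<bar>t\<bar> < d \<Longrightarrow> \<Psi> \<bar>t\<bar> \<le> \<epsilon> * G \<bar>t\<bar>"
    by (auto simp: eventually_at dist_real_def)
  have "eventually (\<lambda>t. H \<bar>t\<bar> > 0) at_top"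
    using eventually_gt_at_top[of "0::real"]
    by eventually_elim (use strict_mono_onD[OF H(1), of 0] H(2) in auto)
  from eventually_le_mult_if_ratio_tendsto_0[OF lim_top this \<epsilon>]
  obtain T0 where T0: "\<And>t. t \<ge> T0 \<Longrightarrow> \<Psi> \<bar>t\<bar> \<le> \<epsilon> * H \<bar>t\<bar>"
    by (auto simp: eventually_at_top_linorder)
  \<comment> \<open>The maximum puts \<open>T\<close> in the half-line, where \<open>\<Psi>\<close>
    is known to be nonnegative and increasing.\<close>
  define T where "T = max 0 T0"
  \<comment> \<open>The middle range includes \<open>t = d\<close>, while the indicator is that of
    an open ray; the threshold \<open>d/2\<close> makes it equal 1 there. The constant
    \<open>\<Psi> T\<close> bounds \<open>\<Psi>\<close> on that range.\<close>
  have "\<Psi> t \<le> \<epsilon> * G t + \<epsilon> * H t + \<Psi> T * indicator {d/2<..} t" if t: "t \<ge> 0" for t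
  proof -
    have ge: "0 \<le> \<epsilon> * G t" "0 \<le> \<epsilon> * H t" "0 \<le> \<Psi> T * indicator {d/2<..} t"
      using nonneg[OF t] nonneg[of T] \<epsilon> by (auto simp: T_def)
    \<comment> \<open>The point 0 is separate because the limit at 0 ignores it; the other ranges
      may overlap.\<close>
    consider "t = 0" | "0 < t" "t < d" | "t \<ge> T" | "d \<le> t" "t < T"
      using t by linarith
    then show ?thesis
    proof cases
      case 1
      then show ?thesis using P ge by simp
    next
      case 2
      then show ?thesis using d(2)[of t] ge by simp
    next
      case 3
      then show ?thesis using T0[of t] t ge by (simp add: T_def)
    next
      case 4
      then show ?thesis
        using strict_mono_on_leD[OF P(1), of t T] ge d(1) t by simp
    qed
  qed
  then show ?thesis
    using d(1) nonneg(3)[of T] by (intro exI[of _ "d/2"] conjI exI[of _ "\<Psi> T"]) (auto simp: T_def)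
qed

lemma nn_integral_tendsto_0_if_dominated:
  fixes v :: "nat \<Rightarrow> 'a \<Rightarrow> real"
  assumes G: "strict_mono_on {0..} G" "G 0 = 0" and H: "strict_mono_on {0..} H" "H 0 = 0"
    and P: "strict_mono_on {0..} \<Psi>" "\<Psi> 0 = 0"
    and lim0: "((\<lambda>t. \<Psi> \<bar>t\<bar> / G \<bar>t\<bar>) \<longlongrightarrow> 0) (at 0)"
    and lim_top: "((\<lambda>t. \<Psi> \<bar>t\<bar> / H \<bar>t\<bar>) \<longlongrightarrow> 0) at_top"
    and meas [measurable]: "\<And>n. v n \<in> borel_measurable M"
    and bdG: "\<And>n. (\<integral>\<^sup>+x. ennreal (G \<bar>v n x\<bar>) \<partial>M) \<le> ennreal C"
    and bdH: "\<And>n. (\<integral>\<^sup>+x. ennreal (H \<bar>v n x\<bar>) \<partial>M) \<le> ennreal D"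
    and C: "C \<ge> 0" and D: "D \<ge> 0"
    and null: "\<And>\<tau>. \<tau> > 0 \<Longrightarrow> (\<lambda>n. emeasure M {x \<in> space M. \<bar>v n x\<bar> > \<tau>}) \<longlonglongrightarrow> 0"
  shows "(\<lambda>n. \<integral>\<^sup>+x. ennreal (\<Psi> \<bar>v n x\<bar>) \<partial>M) \<longlonglongrightarrow> 0"
\<comment> \<open>Nothing in \<open>ennreal\<close> lies below 0, so the lower half of the order
  criterion is vacuous and left to the closing \<open>simp\<close>.\<close>
proof (rule order_tendstoI)
  fix e :: ennreal assume "0 < e"
  \<comment> \<open>\<open>e\<close> may be infinite; a real \<open>r\<close> strictly below it
    permits real arithmetic.\<close>
  then obtain r where r: "0 < ennreal r" "ennreal r < e"
    using dense[of 0 e] by (metis ennreal_cases top.extremum_strict)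
  have "r > 0"
    using r(1) by simp
  \<comment> \<open>The summand 1 keeps the denominator positive and leaves a slack of
    \<open>\<epsilon>\<close>:
    \<open>\<epsilon> * C + \<epsilon> * D = r - \<epsilon>\<close>.\<close>
  define \<epsilon> where "\<epsilon> = r / (C + D + 1)"
  have \<epsilon>: "\<epsilon> > 0" using \<open>r > 0\<close> C D by (simp add: \<epsilon>_def)
  have "r = \<epsilon> * (C + D + 1)"
    using C D by (simp add: \<epsilon>_def)
  then have "\<epsilon> * C + \<epsilon> * D < r"
    using \<epsilon> by (simp add: algebra_simps)
  obtain \<tau> K where \<tau>: "\<tau> > 0" and K: "K \<ge> 0"
    and bound: "\<And>t. t \<ge> 0 \<Longrightarrow> \<Psi> t \<le> \<epsilon> * G t + \<epsilon> * H t + K * indicator {\<tau><..} t"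
    using three_range_bound[OF G H P lim0 lim_top \<epsilon>] by blast
  have nonneg: "G t \<ge> 0" "H t \<ge> 0" if "t \<ge> 0" for t
    using strict_mono_on_leD[OF G(1), of 0 t] strict_mono_on_leD[OF H(1), of 0 t] G H that by auto
  note [measurable] = borel_measurable_mono_on_abs[OF G(1)] borel_measurable_mono_on_abs[OF H(1)]
  let ?A = "\<lambda>n. {x \<in> space M. \<bar>v n x\<bar> > \<tau>}"
  have le: "(\<integral>\<^sup>+x. ennreal (\<Psi> \<bar>v n x\<bar>) \<partial>M)
      \<le> ennreal (\<epsilon> * C + \<epsilon> * D) + ennreal K * emeasure M (?A n)" for n
  proof -
    have "(\<integral>\<^sup>+x. ennreal (\<Psi> \<bar>v n x\<bar>) \<partial>M)
      \<le> (\<integral>\<^sup>+x. ennreal \<epsilon> * ennreal (G \<bar>v n x\<bar>) + ennreal \<epsilon> * ennreal (H \<bar>v n x\<bar>)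
            + ennreal K * indicator (?A n) x \<partial>M)"
    proof (rule nn_integral_mono)
      fix x assume "x \<in> space M"
      \<comment> \<open>The ray indicator at \<open>\<bar>v n x\<bar>\<close> becomes the indicator
        of the superlevel set; nonnegativity of all terms lets \<open>ennreal\<close> distribute
        over sums and products.\<close>
      then have "ennreal \<epsilon> * ennreal (G \<bar>v n x\<bar>) + ennreal \<epsilon> * ennreal (H \<bar>v n x\<bar>)
            + ennreal K * indicator (?A n) x
          = ennreal (\<epsilon> * G \<bar>v n x\<bar> + \<epsilon> * H \<bar>v n x\<bar> + K * indicator {\<tau><..} \<bar>v n x\<bar>)"
        using nonneg[of "\<bar>v n x\<bar>"] \<epsilon> K
        by (auto simp: indicator_def ennreal_mult)
      then show "ennreal (\<Psi> \<bar>v n x\<bar>) \<le> ennreal \<epsilon> * ennreal (G \<bar>v n x\<bar>)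
          + ennreal \<epsilon> * ennreal (H \<bar>v n x\<bar>) + ennreal K * indicator (?A n) x"
        using bound[of "\<bar>v n x\<bar>"] by (simp add: ennreal_leI)
    qed
    also have "\<dots> = ennreal \<epsilon> * (\<integral>\<^sup>+x. ennreal (G \<bar>v n x\<bar>) \<partial>M)
        + ennreal \<epsilon> * (\<integral>\<^sup>+x. ennreal (H \<bar>v n x\<bar>) \<partial>M) + ennreal K * emeasure M (?A n)"
      by (simp add: nn_integral_add nn_integral_cmult nn_integral_cmult_indicator)
    also have "\<dots> \<le> ennreal \<epsilon> * ennreal C + ennreal \<epsilon> * ennreal D + ennreal K * emeasure M (?A n)"
      by (intro add_mono mult_left_mono bdG bdH) auto
    also have "\<dots> = ennreal (\<epsilon> * C + \<epsilon> * D) + ennreal K * emeasure M (?A n)"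
      using \<epsilon> C D by (simp add: ennreal_mult)
    finally show ?thesis .
  qed
  have "(\<lambda>n. ennreal (\<epsilon> * C + \<epsilon> * D) + ennreal K * emeasure M (?A n))
      \<longlonglongrightarrow> ennreal (\<epsilon> * C + \<epsilon> * D) + ennreal K * 0"
    by (intro tendsto_intros ennreal_tendsto_cmult null[OF \<tau>]) simp
  moreover have "ennreal (\<epsilon> * C + \<epsilon> * D) + ennreal K * 0 < e"
    using \<open>\<epsilon> * C + \<epsilon> * D < r\<close> \<open>r > 0\<close> r(2)
    by (simp del: ennreal_plus) (meson ennreal_lessI less_trans)
  ultimately have "eventually (\<lambda>n. ennreal (\<epsilon> * C + \<epsilon> * D) + ennreal K * emeasure M (?A n) < e) sequentially"
    by (rule order_tendstoD(2))
  then show "eventually (\<lambda>n. (\<integral>\<^sup>+x. ennreal (\<Psi> \<bar>v n x\<bar>) \<partial>M) < e) sequentially"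
    by eventually_elim (use le le_less_trans in blast)
qed simp

theorem theorem1p4:
  fixes s :: real and G \<Psi> :: "real \<Rightarrow> real" and u :: "nat \<Rightarrow> real ^ 'n \<Rightarrow> real"
  assumes "CARD('n) \<ge> 3" and "0 < s" and "s < 1"
    and "young_function G" and "young_function \<Psi>"
    and "conjugate_admissible CARD('n) s G"
    and "((\<lambda>t. \<Psi> \<bar>t\<bar> / G \<bar>t\<bar>) \<longlongrightarrow> 0) (at 0)"
    and "((\<lambda>t. \<Psi> \<bar>t\<bar> / sobolev_conjugate CARD('n) s G \<bar>t\<bar>) \<longlongrightarrow> 0) at_top"
    and "\<And>n. u n \<in> orlicz_sobolev_space s G"
    and "\<exists>C<\<infinity>. \<forall>n. (\<integral>\<^sup>+x. ennreal (G \<bar>u n x\<bar>) \<partial>lebesgue) \<le> C"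
    and "\<exists>C<\<infinity>. \<forall>n. (\<integral>\<^sup>+x. ennreal (sobolev_conjugate CARD('n) s G \<bar>u n x\<bar>) \<partial>lebesgue) \<le> C"
    and "\<And>\<tau>. \<tau> > 0 \<Longrightarrow> (\<lambda>n. emeasure lebesgue {x. \<bar>u n x\<bar> > \<tau>}) \<longlonglongrightarrow> 0"
  shows "(\<lambda>n. \<integral>\<^sup>+x. ennreal (\<Psi> \<bar>u n x\<bar>) \<partial>lebesgue) \<longlonglongrightarrow> 0"
proof -
  note G = young_function_bij_betw[OF assms(4)]
  note P = young_function_bij_betw[OF assms(5)]
  have "CARD('n) > 0"
    using assms(1) by simp
  note inv = sobolev_conjugate_inv_bij_betw[OF assms(4,6) this assms(2)]
  \<comment> \<open>Inverting the bijection \<open>sobolev_conjugate_inv\<close> shows that the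
    Sobolev conjugate is increasing and vanishes at 0, as the dominated criterion requires of
    \<open>H\<close>.\<close>
  note H = the_inv_into_strict_mono_on[OF inv, folded sobolev_conjugate_def]
  have meas: "u n \<in> borel_measurable lebesgue" for n
    using assms(9) by (auto simp: orlicz_sobolev_space_def orlicz_space_def)
  from assms(10) obtain C where C: "C \<ge> 0"
    "\<And>n. (\<integral>\<^sup>+x. ennreal (G \<bar>u n x\<bar>) \<partial>lebesgue) \<le> ennreal C"
    by (metis ennreal_cases infinity_ennreal_def less_irrefl)
  from assms(11) obtain D where D: "D \<ge> 0"
    "\<And>n. (\<integral>\<^sup>+x. ennreal (sobolev_conjugate CARD('n) s G \<bar>u n x\<bar>) \<partial>lebesgue) \<le> ennreal D"
    by (metis ennreal_cases infinity_ennreal_def less_irrefl)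
  show ?thesis
    by (rule nn_integral_tendsto_0_if_dominated[OF G(1,3) H P(1,3) assms(7,8) meas C(2) D(2) C(1) D(1)])
      (use assms(12) in simp)
qed

end
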